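(* Let $\mathcal{E}$ be any well-behaved Type-I matcher on a finite set of entities $E$, and let $\{C_1,\dots,C_n\}$ be a cover of $E$. Then the algorithm SMP run with $\mathcal{E}$ on this cover satisfies: 1. (Convergence) SMP terminates after finitely many steps. 2. (Soundness) The set of matches produced by SMP is a subset of $\mathcal{E}(E)$. 3. (Consistency) The output of SMP is invariant under the order in which neighborhoods are evaluated.
   Context: Entities and Type-I matchers. Fix a finite set of entities $E$ (carrying attributes and relations; a subset $C\subseteq E$ carries the induced attributes and relations). A Type-I matcher $\mathcal{E}$ assigns to each subset $C\subseteq E$ and each pair of evidence sets $V_+,V_-\subseteq C\times C$ (known matches, known non-matches) an output set $\mathcal{E}(C,V_+,V_-)\subseteq C\times C$. Write $\mathcal{E}(C,V_+)=\mathcal{E}(C,V_+,\emptyset)$ and $\mathcal{E}(C)=\mathcal{E}(C,\emptyset,\emptyset)$. If $V\subseteq E\times E$ is not contained in $C\times C$, $\mathcal{E}(C,V)$ means $\mathcal{E}(C,V\cap(C\times C))$. $\mathcal{E}$ is idempotent if for all $C,V_+,V_-$, with $O=\mathcal{E}(C,V_+,V_-)$, one has $\mathcal{E}(C,O,V_-)=O$. $\mathcal{E}$ is monotone if whenever $C\subseteq C'$, $V_+\subseteq V_+'$, $V_-\subseteq V_-'$: (i) $\mathcal{E}(C',V_+,V_-)\supseteq\mathcal{E}(C,V_+,V_-)$; (ii) $\mathcal{E}(C,V_+',V_-)\supseteq\mathcal{E}(C,V_+,V_-)$; (iii) $\mathcal{E}(C,V_+,V_-')\subseteq\mathcal{E}(C,V_+,V_-)$.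 $\mathcal{E}$ is well-behaved if it is idempotent and monotone. Covers. A cover of $E$ is a finite family $\{C_1,\dots,C_n\}$ of subsets of $E$ (neighborhoods) with union $E$. For $M\subseteq E\times E$, $\mathrm{Neighbor}(M)$ is the set of neighborhoods affected by $M$, i.e. those $C_i$ with $M\cap(C_i\times C_i)\neq\emptyset$. SMP. Initialize $A=\{C_1,\dots,C_n\}$, $M_+=\emptyset$. While $A\ne\emptyset$: remove some (arbitrarily chosen) neighborhood $C$ from $A$; compute $M_C=\mathcal{E}(C,M_+)$; set $A:=A\cup\mathrm{Neighbor}(M_C\setminus M_+)$; set $M_+:=M_+\cup M_C$. Output $M_+$. *)

theory Defs
  imports Main
begin

(* A matcher maps a set C of entities, known matches and known non-matches to
   matches.  The attributes and relations of the entities are fixed, so those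
   induced on C are determined by C and need no argument of their own.
   As HOL functions are total, all conditions below are relativised to
   C \<subseteq> E and to evidence contained in C \<times> C; values elsewhere are irrelevant. *)
type_synonym 'a matcher =
  "'a set \<Rightarrow> ('a \<times> 'a) set \<Rightarrow> ('a \<times> 'a) set \<Rightarrow> ('a \<times> 'a) set"

definition type_I_matcher :: "'a set \<Rightarrow> 'a matcher \<Rightarrow> bool" where
  "type_I_matcher E \<E> \<longleftrightarrow>
     (\<forall>C Vp Vn. C \<subseteq> E \<and> Vp \<subseteq> C \<times> C \<and> Vn \<subseteq> C \<times> C \<longrightarrow> \<E> C Vp Vn \<subseteq> C \<times> C)"

definition idempotent_matcher :: "'a set \<Rightarrow> 'a matcher \<Rightarrow> bool" where
  "idempotent_matcher E \<E> \<longleftrightarrow>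
     (\<forall>C Vp Vn. C \<subseteq> E \<and> Vp \<subseteq> C \<times> C \<and> Vn \<subseteq> C \<times> C \<longrightarrow>
        \<E> C (\<E> C Vp Vn) Vn = \<E> C Vp Vn)"

definition monotone_matcher :: "'a set \<Rightarrow> 'a matcher \<Rightarrow> bool" where
  "monotone_matcher E \<E> \<longleftrightarrow>
     (\<forall>C C' Vp Vp' Vn Vn'.
        C \<subseteq> C' \<and> C' \<subseteq> E \<and> Vp \<subseteq> Vp' \<and> Vp' \<subseteq> C \<times> C \<and> Vn \<subseteq> Vn' \<and> Vn' \<subseteq> C \<times> C \<longrightarrow>
        \<E> C Vp Vn \<subseteq> \<E> C' Vp Vn \<and>
        \<E> C Vp Vn \<subseteq> \<E> C Vp' Vn \<and>
        \<E> C Vp Vn' \<subseteq> \<E> C Vp Vn)"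

definition well_behaved :: "'a set \<Rightarrow> 'a matcher \<Rightarrow> bool" where
  "well_behaved E \<E> \<longleftrightarrow> idempotent_matcher E \<E> \<and> monotone_matcher E \<E>"

(* The two-argument form, with evidence restricted to the pairs over C. *)
definition match_with :: "'a matcher \<Rightarrow> 'a set \<Rightarrow> ('a \<times> 'a) set \<Rightarrow> ('a \<times> 'a) set" where
  "match_with \<E> C V = \<E> C (V \<inter> C \<times> C) {}"

definition is_cover :: "'a set \<Rightarrow> 'a set set \<Rightarrow> bool" where
  "is_cover E \<C> \<longleftrightarrow> finite \<C> \<and> (\<forall>C\<in>\<C>. C \<subseteq> E) \<and> \<Union>\<C> = E"

definition Neighbor :: "'a set set \<Rightarrow> ('a \<times> 'a) set \<Rightarrow> 'a set set" where
  "Neighbor \<C> M = {C \<in> \<C>. M \<inter> C \<times> C \<noteq> {}}"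

(* States (A, M) are pairs of the active neighborhoods and the matches found so
   far; one step is one iteration of the loop body.  The free choice of C in A
   makes the relation nondeterministic: its runs are the evaluation orders. *)
type_synonym 'a smp_state = "'a set set \<times> ('a \<times> 'a) set"

inductive smp_step :: "'a matcher \<Rightarrow> 'a set set \<Rightarrow> 'a smp_state \<Rightarrow> 'a smp_state \<Rightarrow> bool"
  for \<E> :: "'a matcher" and \<C> :: "'a set set"
where
  "C \<in> A \<Longrightarrow> MC = match_with \<E> C M \<Longrightarrow>
     smp_step \<E> \<C> (A, M) ((A - {C}) \<union> Neighbor \<C> (MC - M), M \<union> MC)"

definition smp_init :: "'a set set \<Rightarrow> 'a smp_state" where
  "smp_init \<C> = (\<C>, {})"

(* Every run is finite, whatever choices are made. *)
definition smp_terminates :: "'a matcher \<Rightarrow> 'a set set \<Rightarrow> bool" where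
  "smp_terminates \<E> \<C> \<longleftrightarrow>
     \<not> (\<exists>s. s 0 = smp_init \<C> \<and> (\<forall>i::nat. smp_step \<E> \<C> (s i) (s (Suc i))))"

(* M is the output of some complete run, i.e. one that exhausts A. *)
definition smp_output :: "'a matcher \<Rightarrow> 'a set set \<Rightarrow> ('a \<times> 'a) set \<Rightarrow> bool" where
  "smp_output \<E> \<C> M \<longleftrightarrow> (smp_step \<E> \<C>)\<^sup>*\<^sup>* (smp_init \<C>) ({}, M)"

end

theory Submission
  imports Defs
begin

text \<open>
  Call \<open>N\<close> closed if evaluating any neighborhood with evidence \<open>N\<close> yields nothing outside \<open>N\<close>.
  By monotonicity every set of matches reachable by SMP lies in every closed set. Conversely,
  a neighborhood that is not active can yield no new match, so the output of a complete run is
  closed. Hence every output is the least closed set, independently of the evaluation order,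
  and soundness follows because \<open>\<E> E {} {}\<close> is closed. Every run is finite because each step
  either adds a match or shrinks the set of active neighborhoods.
\<close>

definition closed_matches :: "'a matcher \<Rightarrow> 'a set set \<Rightarrow> ('a \<times> 'a) set \<Rightarrow> bool" where
  "closed_matches \<E> \<C> N \<longleftrightarrow> (\<forall>C\<in>\<C>. match_with \<E> C N \<subseteq> N)"

lemma match_with_mono:
  assumes "monotone_matcher E \<E>" "C \<subseteq> E" "V \<subseteq> W"
  shows "match_with \<E> C V \<subseteq> match_with \<E> C W"
proof -
  have "V \<inter> C \<times> C \<subseteq> W \<inter> C \<times> C"
    using assms(3) by blast
  then show ?thesis
    using assms(1)[unfolded monotone_matcher_def, rule_format,
        of C C "V \<inter> C \<times> C" "W \<inter> C \<times> C" "{}" "{}"] assms(2)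
    by (auto simp: match_with_def)
qed

lemma match_with_subset:
  assumes "type_I_matcher E \<E>" "C \<subseteq> E"
  shows "match_with \<E> C V \<subseteq> C \<times> C"
  using assms by (simp add: type_I_matcher_def match_with_def)

text \<open>\<open>Neighbor\<close> collects exactly the neighborhoods in which a new match shows
  up; for any other \<open>C\<close> the evidence restricted to \<open>C \<times> C\<close> does not
  change.\<close>

lemma match_with_cong:
  assumes "C \<in> \<C>" "C \<notin> Neighbor \<C> (W - V)"
  shows "match_with \<E> C (V \<union> W) = match_with \<E> C V"
proof -
  have "(V \<union> W) \<inter> C \<times> C = V \<inter> C \<times> C"
    using assms by (auto simp: Neighbor_def)
  then show ?thesis
    by (simp add: match_with_def)
qed

lemma smp_step_active_subset:
  assumes "smp_step \<E> \<C> s t" "fst s \<subseteq> \<C>"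
  shows "fst t \<subseteq> \<C>"
  using assms by (cases rule: smp_step.cases) (auto simp: Neighbor_def)

lemma smp_reachable_active_subset:
  assumes "(smp_step \<E> \<C>)\<^sup>*\<^sup>* (smp_init \<C>) s"
  shows "fst s \<subseteq> \<C>"
  using assms by (induction) (auto simp: smp_init_def dest: smp_step_active_subset)

text \<open>Induction along the run: evidence inside \<open>N\<close> can only yield what evidence
  \<open>N\<close> yields, and closedness keeps that inside \<open>N\<close>.\<close>

lemma smp_reachable_subset_closed:
  assumes "monotone_matcher E \<E>" "is_cover E \<C>" "closed_matches \<E> \<C> N"
    and "(smp_step \<E> \<C>)\<^sup>*\<^sup>* (smp_init \<C>) s"
  shows "snd s \<subseteq> N"
  using assms(4)
proof (induction)
  case base
  then show ?case by (simp add: smp_init_def)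
next
  case (step s t)
  \<comment> \<open>Closedness speaks only of members of the cover, so the chosen neighborhood must
    be known to be one.\<close>
  have sub: "fst s \<subseteq> \<C>"
    using step.hyps(1) by (rule smp_reachable_active_subset)
  from step.hyps(2) show ?case
  proof cases
    case (1 C A MC M)
    then have C: "C \<in> \<C>" using sub by auto
    then have "C \<subseteq> E" using assms(2) by (simp add: is_cover_def)
    then have "MC \<subseteq> match_with \<E> C N"
      using match_with_mono[OF assms(1)] 1 step.IH by simp
    also have "\<dots> \<subseteq> N"
      using C assms(3) by (simp add: closed_matches_def)
    finally show ?thesis
      using 1 step.IH by simp
  qed
qed

text \<open>The loop invariant behind closedness of outputs: once no neighborhood is active, it
  covers all of \<open>\<C>\<close>.\<close>

lemma smp_reachable_inactive_saturated:
  assumes "(smp_step \<E> \<C>)\<^sup>*\<^sup>* (smp_init \<C>) s" "C \<in> \<C>" "C \<notin> fst s"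
  shows "match_with \<E> C (snd s) \<subseteq> snd s"
  using assms
proof (induction)
  case base
  then show ?case by (simp add: smp_init_def)
next
  case (step s t)
  from step.hyps(2) show ?case
  proof cases
    case (1 D A MD M)
    then have "C \<notin> Neighbor \<C> (MD - M)" using step.prems by simp
    then have "match_with \<E> C (M \<union> MD) = match_with \<E> C M"
      using step.prems by (intro match_with_cong)
    \<comment> \<open>If \<open>C = D\<close>, its yield on \<open>M\<close> is \<open>MD\<close>,
      which has just been added. Otherwise \<open>C\<close> was inactive before the step, and the
      induction hypothesis applies.\<close>
    then show ?thesis using 1 step by (cases "C = D") auto
  qed
qed

lemma smp_output_closed:
  assumes "smp_output \<E> \<C> M"
  shows "closed_matches \<E> \<C> M"
  using smp_reachable_inactive_saturated[OF assms[unfolded smp_output_def]]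
  by (simp add: closed_matches_def)

lemma smp_output_subset_closed:
  assumes "monotone_matcher E \<E>" "is_cover E \<C>" "smp_output \<E> \<C> M" "closed_matches \<E> \<C> N"
  shows "M \<subseteq> N"
  using smp_reachable_subset_closed[OF assms(1,2,4) assms(3)[unfolded smp_output_def]] by simp

text \<open>Enlarge first the entity set, then the evidence, both by monotonicity; idempotence on
  \<open>E\<close> closes the chain.\<close>

lemma full_matches_closed:
  assumes "type_I_matcher E \<E>" "well_behaved E \<E>" "is_cover E \<C>"
  shows "closed_matches \<E> \<C> (\<E> E {} {})"
  unfolding closed_matches_def
proof
  fix C assume "C \<in> \<C>"
  then have C: "C \<subseteq> E" using assms(3) by (simp add: is_cover_def)
  let ?O = "\<E> E {} {}"
  have mono: "monotone_matcher E \<E>" and idem: "\<E> E ?O {} = ?O"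
    using assms(2) by (auto simp: well_behaved_def idempotent_matcher_def)
  have O: "?O \<subseteq> E \<times> E"
    using assms(1) by (simp add: type_I_matcher_def)
  \<comment> \<open>The evidence stays cut to \<open>C \<times> C\<close> here, since monotonicity
    in the entity set is assumed only for evidence over the smaller set.\<close>
  have "match_with \<E> C ?O \<subseteq> \<E> E (?O \<inter> C \<times> C) {}"
    using mono[unfolded monotone_matcher_def, rule_format,
        of C E "?O \<inter> C \<times> C" "?O \<inter> C \<times> C" "{}" "{}"] C
    by (simp add: match_with_def)
  also have "\<dots> \<subseteq> \<E> E ?O {}"
    using mono[unfolded monotone_matcher_def, rule_format,
        of E E "?O \<inter> C \<times> C" ?O "{}" "{}"] O by simp
  finally show "match_with \<E> C ?O \<subseteq> ?O"
    by (simp add: idem)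
qed

text \<open>The order is lexicographic, with the pairs not yet found counted first: a new match may
  reactivate many neighborhoods, while a step without one reactivates none and loses
  \<open>C\<close>.\<close>

lemma smp_step_decreasing:
  assumes "finite E" "type_I_matcher E \<E>" "is_cover E \<C>"
    and step: "smp_step \<E> \<C> s t" and active: "fst s \<subseteq> \<C>"
  shows "(t, s) \<in> measures [\<lambda>s. card (E \<times> E - snd s), \<lambda>s. card (fst s)]"
  using step
proof cases
  case (1 C A MC M)
  have C: "C \<in> \<C>" using 1 active by auto
  then have "C \<subseteq> E" using assms(3) by (simp add: is_cover_def)
  then have MC: "MC \<subseteq> E \<times> E"
    using match_with_subset[OF assms(2)] 1 by blast
  show ?thesis
  proof (cases "MC \<subseteq> M")
    case True
    have "finite A"
      using active 1 assms(3) finite_subset by (auto simp: is_cover_def)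
    then have "card (A - {C}) < card A"
      using 1 by (intro card_Diff1_less)
    moreover have "Neighbor \<C> (MC - M) = {}" "M \<union> MC = M"
      using True by (auto simp: Neighbor_def)
    ultimately show ?thesis
      unfolding 1(1,2) by simp
  next
    case False
    then have "E \<times> E - (M \<union> MC) \<subset> E \<times> E - M"
      using MC by blast
    then have "card (E \<times> E - (M \<union> MC)) < card (E \<times> E - M)"
      using assms(1) by (intro psubset_card_mono) auto
    then show ?thesis using 1 by simp
  qed
qed

lemma smp_terminates_finite:
  assumes "finite E" "type_I_matcher E \<E>" "is_cover E \<C>"
  shows "smp_terminates \<E> \<C>"
  unfolding smp_terminates_def
proof (rule notI, elim exE conjE)
  fix s assume init: "s 0 = smp_init \<C>"
    and run: "\<forall>i::nat. smp_step \<E> \<C> (s i) (s (Suc i))"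
  have active: "fst (s i) \<subseteq> \<C>" for i
  proof (induction i)
    case 0
    then show ?case by (simp add: init smp_init_def)
  next
    case (Suc i)
    then show ?case using run smp_step_active_subset by blast
  qed
  have "(s (Suc i), s i) \<in> measures [\<lambda>s. card (E \<times> E - snd s), \<lambda>s. card (fst s)]" for i
    using smp_step_decreasing[OF assms] run active by blast
  then show False
    using wf_measures unfolding wf_iff_no_infinite_down_chain by blast
qed

theorem theorem2:
  fixes E :: "'a set" and \<E> :: "'a matcher" and \<C> :: "'a set set"
  assumes "finite E"
    and "type_I_matcher E \<E>"
    and "well_behaved E \<E>"
    and "is_cover E \<C>"
  shows "smp_terminates \<E> \<C> \<and>
         (\<forall>M. smp_output \<E> \<C> M \<longrightarrow> M \<subseteq> \<E> E {} {}) \<and>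
         (\<forall>M M'. smp_output \<E> \<C> M \<longrightarrow> smp_output \<E> \<C> M' \<longrightarrow> M = M')"
proof -
  have "monotone_matcher E \<E>"
    using assms(3) by (simp add: well_behaved_def)
  \<comment> \<open>With \<open>\<E> E {} {}\<close> as the closed set this gives soundness; with a
    second output in that place, used both ways, it gives consistency.\<close>
  note least = smp_output_subset_closed[OF this assms(4)]
  show ?thesis
    using smp_terminates_finite[OF assms(1,2,4)] full_matches_closed[OF assms(2-4)]
      least smp_output_closed by (blast intro: subset_antisym)
qed

end
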